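(* Let $k\geq 2$ be a constant and let $\Phi$ be a random $k$-SAT formula on $n$ variables with $m$ clauses and variable distribution $\vec p=(p_1,\dots,p_n)$, where the $p_i$ are ordered so that $p_1\le p_2\le\dots\le p_n$. Suppose $\tfrac mn=\Omega(1)$. If $p_{n-k+1}=\Omega\big((\tfrac{\log n}{n})^{1/k}\big)$, then $\Phi$ is unsatisfiable with high probability.
   Context: Random $k$-SAT model: given $n$ Boolean variables $x_1,\dots,x_n$, a number of clauses $m$, and a probability distribution $\vec p$ on $\{1,\dots,n\}$ with $\sum_i p_i=1$, the formula $\Phi$ is the conjunction of $m$ clauses sampled independently. Each clause is sampled by (1) selecting $k$ variables independently at random from $\vec p$, repeating until no two of the $k$ variables coincide, and (2) negating each of the $k$ variables independently with probability $1/2$. Asymptotics are as $n\to\infty$ with $k$ fixed. An event holds with high probability (w.h.p.) if there is $\delta>0$ such that it has probability at least $1-O(n^{-\delta})$. *)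

theory Defs
  imports "HOL-Probability.Probability" "HOL-Library.Landau_Symbols"
begin

type_synonym var = nat

text \<open>The Boolean component is \<^term>\<open>True\<close> for a negated literal.\<close>
type_synonym literal = "var \<times> bool"

type_synonym clause = "literal list"
type_synonym cnf = "clause list"

definition lit_sat :: "(var \<Rightarrow> bool) \<Rightarrow> literal \<Rightarrow> bool" where
  "lit_sat a l \<longleftrightarrow> (if snd l then \<not> a (fst l) else a (fst l))"

definition clause_sat :: "(var \<Rightarrow> bool) \<Rightarrow> clause \<Rightarrow> bool" where
  "clause_sat a c \<longleftrightarrow> (\<exists>l\<in>set c. lit_sat a l)"

definition cnf_sat :: "(var \<Rightarrow> bool) \<Rightarrow> cnf \<Rightarrow> bool" where
  "cnf_sat a F \<longleftrightarrow> (\<forall>c\<in>set F. clause_sat a c)"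

definition satisfiable :: "cnf \<Rightarrow> bool" where
  "satisfiable F \<longleftrightarrow> (\<exists>a. cnf_sat a F)"

text \<open>
  Drawing \<^term>\<open>k\<close> variables independently and repeating until they are pairwise distinct
  gives the law of \<^term>\<open>k\<close> independent draws conditioned on distinctness (see
  \<open>rejection_sampling_iff_cond_pmf\<close> below). If fewer than \<^term>\<open>k\<close> variables have positive
  probability, the repetition never ends, and \<^const>\<open>cond_pmf\<close> is an unspecified distribution.
\<close>
definition clause_vars_pmf :: "nat \<Rightarrow> var pmf \<Rightarrow> var list pmf" where
  "clause_vars_pmf k p = cond_pmf (replicate_pmf k p) {xs. distinct xs}"

definition clause_pmf :: "nat \<Rightarrow> var pmf \<Rightarrow> clause pmf" where
  "clause_pmf k p =
     do {
       xs \<leftarrow> clause_vars_pmf k p;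
       negs \<leftarrow> replicate_pmf k (bernoulli_pmf (1/2));
       return_pmf (zip xs negs)
     }"

definition random_ksat :: "nat \<Rightarrow> nat \<Rightarrow> var pmf \<Rightarrow> cnf pmf" where
  "random_ksat k m p = replicate_pmf m (clause_pmf k p)"

definition whp :: "(nat \<Rightarrow> 'a pmf) \<Rightarrow> (nat \<Rightarrow> 'a \<Rightarrow> bool) \<Rightarrow> bool" where
  "whp M E \<longleftrightarrow>
     (\<exists>\<delta>>0. \<exists>err \<in> O(\<lambda>n. real n powr (- \<delta>)).
        \<forall>\<^sub>F n in at_top. measure_pmf.prob (M n) {x. E n x} \<ge> 1 - err n)"

text \<open>
  The outcome law of the loop ``draw from \<open>M\<close> until the result lies in \<open>A\<close>'' is the unique
  solution \<open>D\<close> of the unfolding equation below.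
\<close>
lemma rejection_sampling_iff_cond_pmf:
  assumes "set_pmf M \<inter> A \<noteq> {}"
  shows "D = bind_pmf M (\<lambda>x. if x \<in> A then return_pmf x else D) \<longleftrightarrow> D = cond_pmf M A"
proof -
  let ?P = "measure_pmf.prob M A"
  have pos: "?P > 0"
    using assms by (meson disjoint_iff measure_pmf_posI)
  have unfold: "pmf (bind_pmf M (\<lambda>x. if x \<in> A then return_pmf x else D)) y =
      (if y \<in> A then pmf M y else 0) + (1 - ?P) * pmf D y" for y
  proof -
    have "pmf (bind_pmf M (\<lambda>x. if x \<in> A then return_pmf x else D)) y =
        measure_pmf.expectation M (\<lambda>x. indicator ({y} \<inter> A) x + pmf D y * indicator (- A) x)"
      unfolding pmf_bind
      by (intro Bochner_Integration.integral_cong) (auto simp: indicator_def)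
    also have "\<dots> = measure_pmf.prob M ({y} \<inter> A) + pmf D y * measure_pmf.prob M (- A)"
      by (subst Bochner_Integration.integral_add)
        (auto intro!: measure_pmf.integrable_const_bound[where B = 1])
    also have "measure_pmf.prob M (- A) = 1 - ?P"
      using measure_pmf.prob_compl[of A M] by (simp add: Compl_eq_Diff_UNIV)
    also have "measure_pmf.prob M ({y} \<inter> A) = (if y \<in> A then pmf M y else 0)"
      by (auto simp: pmf.rep_eq)
    finally show ?thesis by (simp add: mult.commute)
  qed
  have "D = bind_pmf M (\<lambda>x. if x \<in> A then return_pmf x else D) \<longleftrightarrow>
      (\<forall>y. pmf D y = (if y \<in> A then pmf M y else 0) + (1 - ?P) * pmf D y)"
    by (subst pmf_eq_iff) (simp only: unfold)
  also have "\<dots> \<longleftrightarrow> (\<forall>y. pmf D y = (if y \<in> A then pmf M y / ?P else 0))"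
    using pos by (intro all_cong1) (auto simp: field_simps)
  also have "\<dots> \<longleftrightarrow> D = cond_pmf M A"
    by (simp add: pmf_eq_iff pmf_cond[OF assms])
  finally show ?thesis .
qed

end

theory Submission
  imports Defs
begin

text \<open>
  A fixed clause on the \<open>k\<close> most likely variables has probability at least
  \<open>(p\<^bsub>n-k+1\<^esub> / 2)\<^sup>k = \<Omega>(log n / n)\<close>. Among \<open>\<Omega>(n)\<close> independent clauses it is therefore missing
  with probability at most \<open>n\<^bsup>-\<delta>\<^esup>\<close>, and by a union bound all \<open>2\<^sup>k\<close> sign patterns on these
  variables occur with high probability; together they exclude every assignment.
\<close>

lemma pmf_replicate_pmf:
  "pmf (replicate_pmf (length xs) p) xs = (\<Prod>x\<leftarrow>xs. pmf p x)"
proof (induction xs)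
  case (Cons x xs)
  have "replicate_pmf (Suc (length xs)) p =
      map_pmf (\<lambda>(y, ys). y # ys) (pair_pmf p (replicate_pmf (length xs) p))"
    by (simp add: pair_pmf_def map_bind_pmf)
  moreover have "pmf \<dots> (x # xs) = pmf (pair_pmf p (replicate_pmf (length xs) p)) (x, xs)"
    using pmf_map_inj'[of "\<lambda>(y, ys). y # ys" _ "(x, xs)"] by (auto simp: inj_def)
  ultimately show ?case
    using Cons.IH by (simp add: pmf_pair)
qed simp

lemma prob_pair_pmf_Times:
  "measure_pmf.prob (pair_pmf p q) (A \<times> B) = measure_pmf.prob p A * measure_pmf.prob q B"
proof -
  \<comment> \<open>The product rule \<open>measure_pmf_prob_product\<close> is for countable sets,
    so \<open>A\<close> and \<open>B\<close> are first cut down to the supports of \<open>p\<close>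
    and \<open>q\<close>, which changes no probability.\<close>
  have "measure_pmf.prob (pair_pmf p q) (A \<times> B) =
      measure_pmf.prob (pair_pmf p q) ((A \<times> B) \<inter> set_pmf (pair_pmf p q))"
    by (rule measure_Int_set_pmf[symmetric])
  also have "(A \<times> B) \<inter> set_pmf (pair_pmf p q) = (A \<inter> set_pmf p) \<times> (B \<inter> set_pmf q)"
    by auto
  also have "measure_pmf.prob (pair_pmf p q) \<dots> =
      measure_pmf.prob p (A \<inter> set_pmf p) * measure_pmf.prob q (B \<inter> set_pmf q)"
    by (intro measure_pmf_prob_product) (auto intro: countable_Int2)
  finally show ?thesis
    by (simp add: measure_Int_set_pmf)
qed

lemma prob_replicate_pmf_notin_set:
  "measure_pmf.prob (replicate_pmf m p) {xs. c \<notin> set xs} = (1 - pmf p c) ^ m"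
proof (induction m)
  case (Suc m)
  have "replicate_pmf (Suc m) p = map_pmf (\<lambda>(y, ys). y # ys) (pair_pmf p (replicate_pmf m p))"
    by (simp add: pair_pmf_def map_bind_pmf)
  moreover have "(\<lambda>(y, ys). y # ys) -` {xs. c \<notin> set xs} = (- {c}) \<times> {xs. c \<notin> set xs}"
    by auto
  moreover have "measure_pmf.prob p (- {c}) = 1 - pmf p c"
    using measure_pmf.prob_compl[of "{c}" p] by (simp add: Compl_eq_Diff_UNIV measure_pmf_single)
  ultimately show ?case
    using Suc.IH by (simp add: prob_pair_pmf_Times)
qed simp

text \<open>Conditioning on distinctness divides the mass of a distinct list by a probability at
  most 1, so it can only raise it above \<open>q ^ length xs\<close>; the independent signs
  contribute the factor \<open>(1/2) ^ length xs\<close>. Positivity of \<open>q\<close> puts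
  \<open>xs\<close> into the support, so the conditioning event has positive probability and
  \<open>cond_pmf\<close> is the intended law.\<close>

lemma pmf_clause_pmf_ge:
  assumes "distinct xs" "length bs = length xs" "0 < q" "\<And>x. x \<in> set xs \<Longrightarrow> q \<le> pmf p x"
  shows "(q / 2) ^ length xs \<le> pmf (clause_pmf (length xs) p) (zip xs bs)"
proof -
  let ?k = "length xs"
  let ?R = "replicate_pmf ?k p" and ?B = "replicate_pmf ?k (bernoulli_pmf (1/2))"
  have R: "q ^ ?k \<le> pmf ?R xs"
    using assms(3,4) unfolding pmf_replicate_pmf
    by (induction xs) (auto intro!: mult_mono)
  have ne: "set_pmf ?R \<inter> {xs. distinct xs} \<noteq> {}"
  proof -
    have "0 < pmf ?R xs"
      using R \<open>0 < q\<close> by (meson less_le_trans zero_less_power)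
    then have "xs \<in> set_pmf ?R"
      by (simp add: set_pmf_iff)
    then show ?thesis
      using assms(1) by blast
  qed
  then have P: "measure_pmf.prob ?R {xs. distinct xs} > 0"
    by (meson disjoint_iff measure_pmf_posI)
  have q: "q ^ ?k \<le> pmf (clause_vars_pmf ?k p) xs"
  proof -
    have "pmf (clause_vars_pmf ?k p) xs = pmf ?R xs / measure_pmf.prob ?R {xs. distinct xs}"
      unfolding clause_vars_pmf_def using assms(1) by (simp add: pmf_cond[OF ne])
    also have "\<dots> \<ge> pmf ?R xs"
      using P by (simp add: le_divide_eq mult_left_le)
    finally show ?thesis
      using R by simp
  qed
  have "pmf ?B bs = (1/2) ^ ?k"
  proof -
    have "pmf (bernoulli_pmf (1/2)) b = 1/2" for b
      by (cases b) auto
    then have "pmf (replicate_pmf (length bs) (bernoulli_pmf (1/2))) bs = (1/2) ^ length bs"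
      by (simp add: pmf_replicate_pmf map_replicate_const)
    then show ?thesis
      by (simp add: assms(2))
  qed
  \<comment> \<open>The mass of a point under a mapped distribution is the measure of its preimage,
    which contains \<open>(xs, bs)\<close>. Settling for an inequality avoids any injectivity
    argument for \<open>zip\<close>.\<close>
  moreover have "pmf (pair_pmf (clause_vars_pmf ?k p) ?B) (xs, bs)
      \<le> pmf (clause_pmf ?k p) (zip xs bs)"
  proof -
    have "clause_pmf ?k p = map_pmf (\<lambda>(xs, bs). zip xs bs) (pair_pmf (clause_vars_pmf ?k p) ?B)"
      by (simp add: clause_pmf_def pair_pmf_def map_bind_pmf)
    then show ?thesis
      by (auto simp: pmf_map simp flip: measure_pmf_single intro!: measure_pmf.finite_measure_mono)
  qed
  ultimately have "pmf (clause_vars_pmf ?k p) xs * (1/2) ^ ?k \<le> pmf (clause_pmf ?k p) (zip xs bs)"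
    by (simp only: pmf_pair)
  then have "q ^ ?k * (1/2) ^ ?k \<le> pmf (clause_pmf ?k p) (zip xs bs)"
    using mult_right_mono[OF q, of "(1/2) ^ ?k"] by (rule order_trans[rotated]) simp
  then show ?thesis
    by (simp add: power_divide)
qed

text \<open>An assignment \<open>a\<close> is refuted by the sign pattern \<open>map a xs\<close>:
  since \<open>True\<close> marks negation, this clause negates exactly those variables that
  \<open>a\<close> makes true, so each of its literals is false under \<open>a\<close>.\<close>

lemma not_satisfiable_if_all_signs:
  assumes "\<And>bs. length bs = length xs \<Longrightarrow> zip xs bs \<in> set F"
  shows "\<not> satisfiable F"
proof
  assume "satisfiable F"
  then obtain a where a: "cnf_sat a F"
    by (auto simp: satisfiable_def)
  have "zip xs (map a xs) \<in> set F"
    by (simp add: assms)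
  then have "clause_sat a (zip xs (map a xs))"
    using a by (simp add: cnf_sat_def)
  then show False
    by (auto simp: clause_sat_def lit_sat_def set_zip split: if_splits)
qed

text \<open>This union bound is explicit in \<open>q\<close> and \<open>m\<close>, so that
  asymptotics enter only in the final theorem.\<close>

lemma prob_not_satisfiable_ge:
  assumes "distinct xs" "0 < q" "\<And>x. x \<in> set xs \<Longrightarrow> q \<le> pmf p x"
  shows "1 - 2 ^ length xs * exp (- ((q / 2) ^ length xs * real m))
    \<le> measure_pmf.prob (random_ksat (length xs) m p) {F. \<not> satisfiable F}"
proof -
  let ?k = "length xs" and ?S = "{bs :: bool list. length bs = length xs}"
  let ?M = "random_ksat (length xs) m p"
  have fin: "finite ?S" and card: "card ?S = 2 ^ ?k"
    using finite_lists_length_eq[of "UNIV :: bool set" ?k] card_lists_length_eq[of "UNIV :: bool set" ?k]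
    by auto
  have "measure_pmf.prob ?M {F. satisfiable F}
      \<le> measure_pmf.prob ?M (\<Union>bs\<in>?S. {F. zip xs bs \<notin> set F})"
    using not_satisfiable_if_all_signs[of xs]
    by (intro measure_pmf.finite_measure_mono) auto
  also have "\<dots> \<le> (\<Sum>bs\<in>?S. measure_pmf.prob ?M {F. zip xs bs \<notin> set F})"
    by (intro measure_pmf.finite_measure_subadditive_finite fin) auto
  also have "\<dots> \<le> (\<Sum>bs\<in>?S. exp (- ((q / 2) ^ ?k * real m)))"
  proof (intro sum_mono)
    fix bs :: "bool list"
    assume "bs \<in> ?S"
    define r where "r = pmf (clause_pmf ?k p) (zip xs bs)"
    have r: "(q / 2) ^ ?k \<le> r" "r \<le> 1"
      using pmf_clause_pmf_ge[of xs bs q p] assms \<open>bs \<in> ?S\<close> by (auto simp: r_def pmf_le_1)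
    have "measure_pmf.prob ?M {F. zip xs bs \<notin> set F} = (1 - r) ^ m"
      by (simp add: random_ksat_def prob_replicate_pmf_notin_set r_def)
    \<comment> \<open>With t = \<open>(q / 2) ^ ?k\<close> this is 1 - r \<le> 1 - t \<le> exp(-t),
      raised to the power \<open>m\<close>; r \<le> 1 keeps the smaller base nonnegative.\<close>
    also have "\<dots> \<le> exp (- ((q / 2) ^ ?k)) ^ m"
      using r exp_ge_add_one_self[of "- ((q / 2) ^ ?k)"] by (intro power_mono) auto
    also have "\<dots> = exp (- ((q / 2) ^ ?k * real m))"
      using exp_of_nat_mult[of m "- ((q / 2) ^ ?k)"] by (simp add: mult.commute)
    finally show "measure_pmf.prob ?M {F. zip xs bs \<notin> set F} \<le> exp (- ((q / 2) ^ ?k * real m))" .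
  qed
  also have "\<dots> = 2 ^ ?k * exp (- ((q / 2) ^ ?k * real m))"
    by (simp add: card)
  finally show ?thesis
    using measure_pmf.prob_compl[of "{F. satisfiable F}" ?M]
    by (simp add: set_diff_eq)
qed

theorem theorem8:
  fixes k :: nat and m :: "nat \<Rightarrow> nat" and p :: "nat \<Rightarrow> nat pmf"
  assumes "k \<ge> 2"
    and "\<And>n. n \<ge> 1 \<Longrightarrow> set_pmf (p n) \<subseteq> {1..n}"
    and "\<And>n i j. 1 \<le> i \<Longrightarrow> i \<le> j \<Longrightarrow> j \<le> n \<Longrightarrow> pmf (p n) i \<le> pmf (p n) j"
    and "(\<lambda>n. real (m n) / real n) \<in> \<Omega>(\<lambda>n. 1)"
    and "(\<lambda>n. pmf (p n) (n - k + 1)) \<in> \<Omega>(\<lambda>n. (ln (real n) / real n) powr (1 / real k))"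
  shows "whp (\<lambda>n. random_ksat k (m n) (p n)) (\<lambda>n \<Phi>. \<not> satisfiable \<Phi>)"
proof -
  obtain d where "d > 0" and ev_d: "\<forall>\<^sub>F n in at_top. norm (real (m n) / real n) \<ge> d * norm (1 :: real)"
    using landau_omega.bigE[OF assms(4)] by blast
  obtain c where "c > 0" and ev_c: "\<forall>\<^sub>F n in at_top. norm (pmf (p n) (n - k + 1))
      \<ge> c * norm ((ln (real n) / real n) powr (1 / real k))"
    using landau_omega.bigE[OF assms(5)] by blast
  \<comment> \<open>The exponent is at least \<open>(c / 2) ^ k * (ln n / n)\<close> times
    \<open>d * n\<close>, that is \<open>\<delta> * ln n\<close>, and exp of its negative is at most
    \<open>n powr (- \<delta>)\<close>.\<close>
  define \<delta> where "\<delta> = (c / 2) ^ k * d"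
  have "\<delta> > 0"
    using \<open>c > 0\<close> \<open>d > 0\<close> by (simp add: \<delta>_def)
  have "\<forall>\<^sub>F n in at_top. 1 - 2 ^ k * real n powr (- \<delta>)
      \<le> measure_pmf.prob (random_ksat k (m n) (p n)) {\<Phi>. \<not> satisfiable \<Phi>}"
    \<comment> \<open>The bound n \<ge> k makes the natural subtraction in \<open>n - k + 1\<close>
      exact; together with k \<ge> 2 it also gives \<open>ln n > 0\<close>, hence
      \<open>q > 0\<close> below.\<close>
    using ev_d ev_c eventually_ge_at_top[of k]
  proof eventually_elim
    case (elim n)
    have n: "n \<ge> 2" "ln (real n) > 0"
      using elim(3) assms(1) by auto
    define q where "q = c * (ln (real n) / real n) powr (1 / real k)"
    \<comment> \<open>These are the \<open>k\<close> indices n-k+1, ..., n (the upper end of the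
      interval is exclusive). By the ordering of the probabilities, the lower bound at the first
      index holds at all of them.\<close>
    define xs where "xs = [n - k + 1..<n + 1]"
    have len: "length xs = k"
      using elim(3) assms(1) by (simp add: xs_def)
    have "0 < q"
      using n \<open>c > 0\<close> by (simp add: q_def)
    have q_le: "q \<le> pmf (p n) x" if "x \<in> set xs" for x
    proof -
      have "q \<le> pmf (p n) (n - k + 1)"
        using elim(2) by (simp add: q_def)
      also have "\<dots> \<le> pmf (p n) x"
        using that by (intro assms(3)) (auto simp: xs_def)
      finally show ?thesis .
    qed
    have "distinct xs"
      by (simp add: xs_def)
    from prob_not_satisfiable_ge[OF this \<open>0 < q\<close> q_le, where m = "m n"]
    have main: "1 - 2 ^ k * exp (- ((q / 2) ^ k * real (m n)))
        \<le> measure_pmf.prob (random_ksat k (m n) (p n)) {\<Phi>. \<not> satisfiable \<Phi>}"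
      unfolding len .
    have q_pow: "(q / 2) ^ k = (c / 2) ^ k * (ln (real n) / real n)"
    proof -
      \<comment> \<open>The exponent 1/k in the hypothesis on the probabilities cancels against the
        \<open>k\<close> variables of a clause.\<close>
      have "((ln (real n) / real n) powr (1 / real k)) ^ k = ln (real n) / real n"
        using n assms(1) by (simp add: powr_powr flip: powr_realpow)
      then show ?thesis
        by (simp add: q_def power_mult_distrib power_divide)
    qed
    have "d * real n \<le> real (m n)"
      using elim(1) n by (simp add: field_simps)
    then have "(q / 2) ^ k * (d * real n) \<le> (q / 2) ^ k * real (m n)"
      using \<open>0 < q\<close> by (intro mult_left_mono) auto
    moreover have "(q / 2) ^ k * (d * real n) = \<delta> * ln (real n)"
      using n by (simp add: q_pow \<delta>_def)
    ultimately have "\<delta> * ln (real n) \<le> (q / 2) ^ k * real (m n)"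
      by simp
    then have "exp (- ((q / 2) ^ k * real (m n))) \<le> real n powr (- \<delta>)"
      using n by (simp add: powr_def)
    then have "2 ^ k * exp (- ((q / 2) ^ k * real (m n))) \<le> 2 ^ k * real n powr (- \<delta>)"
      by simp
    with main show ?case
      by linarith
  qed
  \<comment> \<open>The number of sign patterns is constant in \<open>n\<close>, so the union bound
    costs nothing in the rate.\<close>
  moreover have "(\<lambda>n. 2 ^ k * real n powr (- \<delta>)) \<in> O(\<lambda>n. real n powr (- \<delta>))"
    by simp
  ultimately show ?thesis
    unfolding whp_def using \<open>\<delta> > 0\<close>
    by (intro exI[of _ \<delta>] conjI bexI[of _ "\<lambda>n. 2 ^ k * real n powr (- \<delta>)"])
qed

end
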